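(* The class of CSA-groups is closed under direct limits: if $(G_i)_{i\in I}$ is a direct system (over a directed set $I$) of CSA-groups and group homomorphisms, then $\varinjlim G_i$ is a CSA-group.
   Context: A subgroup $H$ of a group $G$ is conjugately separated (malnormal) if $H\cap H^x=1$ for every $x\in G\setminus H$, where $H^x=x^{-1}Hx$. A group $G$ is a CSA-group if all its maximal abelian subgroups are conjugately separated. *)

theory Defs
  imports "HOL-Algebra.Coset"
begin

section \<open>CSA-groups\<close>

definition conjugately_separated :: "'a set \<Rightarrow> ('a, 'm) monoid_scheme \<Rightarrow> bool" where
  "conjugately_separated H G \<longleftrightarrow> subgroup H G \<and>
     (\<forall>x \<in> carrier G - H. H \<inter> ((inv\<^bsub>G\<^esub> x <#\<^bsub>G\<^esub> H) #>\<^bsub>G\<^esub> x) = {\<one>\<^bsub>G\<^esub>})"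

definition abelian_subgroup :: "'a set \<Rightarrow> ('a, 'm) monoid_scheme \<Rightarrow> bool" where
  "abelian_subgroup H G \<longleftrightarrow> subgroup H G \<and> comm_group (G\<lparr>carrier := H\<rparr>)"

definition maximal_abelian_subgroup :: "'a set \<Rightarrow> ('a, 'm) monoid_scheme \<Rightarrow> bool" where
  "maximal_abelian_subgroup H G \<longleftrightarrow> abelian_subgroup H G \<and>
     (\<forall>K. abelian_subgroup K G \<and> H \<subseteq> K \<longrightarrow> K = H)"

definition CSA_group :: "('a, 'm) monoid_scheme \<Rightarrow> bool" where
  "CSA_group G \<longleftrightarrow> group G \<and>
     (\<forall>H. maximal_abelian_subgroup H G \<longrightarrow> conjugately_separated H G)"

section \<open>Direct systems of groups\<close>

text \<open>A directed set is a nonempty preordered set in which any two elements have an upper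
  bound. Antisymmetry is not required, so directed partial orders are included.\<close>

locale directed_index =
  fixes I :: "'i set" and leq :: "'i \<Rightarrow> 'i \<Rightarrow> bool"
  assumes nonempty: "I \<noteq> {}"
    and le_refl: "reflp_on I leq"
    and le_trans: "transp_on I leq"
    and upper_bound: "\<And>i j. i \<in> I \<Longrightarrow> j \<in> I \<Longrightarrow> \<exists>k\<in>I. leq i k \<and> leq j k"

text \<open>The transition map from \<open>i\<close> to \<open>j\<close> is \<open>f i j\<close>; it is constrained only for indices in
  \<open>I\<close> with \<open>leq i j\<close>, and only on the carrier of \<open>G i\<close>.\<close>

locale direct_system = directed_index I leq
  for I :: "'i set" and leq :: "'i \<Rightarrow> 'i \<Rightarrow> bool" +
  fixes G :: "'i \<Rightarrow> ('a, 'm) monoid_scheme" and f :: "'i \<Rightarrow> 'i \<Rightarrow> 'a \<Rightarrow> 'a"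
  assumes groups: "\<And>i. i \<in> I \<Longrightarrow> group (G i)"
    and trans_hom: "\<And>i j. i \<in> I \<Longrightarrow> j \<in> I \<Longrightarrow> leq i j \<Longrightarrow> f i j \<in> hom (G i) (G j)"
    and trans_id: "\<And>i x. i \<in> I \<Longrightarrow> x \<in> carrier (G i) \<Longrightarrow> f i i x = x"
    and trans_comp: "\<And>i j k x. i \<in> I \<Longrightarrow> j \<in> I \<Longrightarrow> k \<in> I \<Longrightarrow> leq i j \<Longrightarrow> leq j k \<Longrightarrow>
          x \<in> carrier (G i) \<Longrightarrow> f j k (f i j x) = f i k x"

section \<open>The direct limit\<close>

text \<open>The disjoint union of the carriers modulo the relation identifying two elements that
  become equal at some later index.\<close>

definition dirlim_rel ::
  "'i set \<Rightarrow> ('i \<Rightarrow> 'i \<Rightarrow> bool) \<Rightarrow> ('i \<Rightarrow> ('a, 'm) monoid_scheme) \<Rightarrow> ('i \<Rightarrow> 'i \<Rightarrow> 'a \<Rightarrow> 'a)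
     \<Rightarrow> (('i \<times> 'a) \<times> ('i \<times> 'a)) set" where
  "dirlim_rel I leq G f =
     {((i, x), (j, y)) | i x j y. i \<in> I \<and> x \<in> carrier (G i) \<and> j \<in> I \<and> y \<in> carrier (G j) \<and>
        (\<exists>k\<in>I. leq i k \<and> leq j k \<and> f i k x = f j k y)}"

text \<open>The unions below are over representatives (and upper bounds) and do not depend on these
  choices; see \<open>mult_dirlim_in\<close> and \<open>one_dirlim\<close>.\<close>

definition direct_limit ::
  "'i set \<Rightarrow> ('i \<Rightarrow> 'i \<Rightarrow> bool) \<Rightarrow> ('i \<Rightarrow> ('a, 'm) monoid_scheme) \<Rightarrow> ('i \<Rightarrow> 'i \<Rightarrow> 'a \<Rightarrow> 'a)
     \<Rightarrow> ('i \<times> 'a) set monoid" where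
  "direct_limit I leq G f =
     \<lparr> carrier = (SIGMA i:I. carrier (G i)) // dirlim_rel I leq G f,
       mult = (\<lambda>A B. \<Union>{dirlim_rel I leq G f `` {(k, f i k x \<otimes>\<^bsub>G k\<^esub> f j k y)} | i x j y k.
                 (i, x) \<in> A \<and> (j, y) \<in> B \<and> k \<in> I \<and> leq i k \<and> leq j k}),
       one = (\<Union>i\<in>I. dirlim_rel I leq G f `` {(i, \<one>\<^bsub>G i\<^esub>)}) \<rparr>"

definition dirlim_in ::
  "'i set \<Rightarrow> ('i \<Rightarrow> 'i \<Rightarrow> bool) \<Rightarrow> ('i \<Rightarrow> ('a, 'm) monoid_scheme) \<Rightarrow> ('i \<Rightarrow> 'i \<Rightarrow> 'a \<Rightarrow> 'a)
     \<Rightarrow> 'i \<Rightarrow> 'a \<Rightarrow> ('i \<times> 'a) set" where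
  "dirlim_in I leq G f i x = dirlim_rel I leq G f `` {(i, x)}"

context direct_system
begin

abbreviation "R \<equiv> dirlim_rel I leq G f"
abbreviation "L \<equiv> direct_limit I leq G f"
abbreviation "\<iota> \<equiv> dirlim_in I leq G f"

lemma leI_trans: "i \<in> I \<Longrightarrow> j \<in> I \<Longrightarrow> k \<in> I \<Longrightarrow> leq i j \<Longrightarrow> leq j k \<Longrightarrow> leq i k"
  using le_trans by (meson transp_onD)

lemma leI_refl: "i \<in> I \<Longrightarrow> leq i i"
  using le_refl by (meson reflp_onD)

lemma trans_closed:
  "i \<in> I \<Longrightarrow> j \<in> I \<Longrightarrow> leq i j \<Longrightarrow> x \<in> carrier (G i) \<Longrightarrow> f i j x \<in> carrier (G j)"
  by (rule hom_in_carrier[OF trans_hom])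

lemma trans_mult:
  "i \<in> I \<Longrightarrow> j \<in> I \<Longrightarrow> leq i j \<Longrightarrow> x \<in> carrier (G i) \<Longrightarrow> y \<in> carrier (G i) \<Longrightarrow>
     f i j (x \<otimes>\<^bsub>G i\<^esub> y) = f i j x \<otimes>\<^bsub>G j\<^esub> f i j y"
  by (rule hom_mult[OF trans_hom])

lemma trans_one: "i \<in> I \<Longrightarrow> j \<in> I \<Longrightarrow> leq i j \<Longrightarrow> f i j \<one>\<^bsub>G i\<^esub> = \<one>\<^bsub>G j\<^esub>"
  by (rule hom_one[OF trans_hom groups groups])

lemma rel_iff:
  "((i, x), (j, y)) \<in> R \<longleftrightarrow> i \<in> I \<and> x \<in> carrier (G i) \<and> j \<in> I \<and> y \<in> carrier (G j) \<and>
     (\<exists>k\<in>I. leq i k \<and> leq j k \<and> f i k x = f j k y)"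
  by (auto simp: dirlim_rel_def)

lemma equiv_rel: "equiv (SIGMA i:I. carrier (G i)) R"
proof (rule equivI)
  show "R \<subseteq> (SIGMA i:I. carrier (G i)) \<times> (SIGMA i:I. carrier (G i))"
    by (auto simp: dirlim_rel_def)
  show "refl_on (SIGMA i:I. carrier (G i)) R"
    by (auto simp: refl_on_def rel_iff intro: leI_refl)
  show "sym R"
    by (rule symI) (force simp: dirlim_rel_def)
  show "trans R"
  proof (rule transI, clarify)
    fix i x j y l z
    assume a: "((i, x), (j, y)) \<in> R" and b: "((j, y), (l, z)) \<in> R"
    obtain k where k: "k \<in> I" "leq i k" "leq j k" "f i k x = f j k y"
      using a by (auto simp: rel_iff)
    obtain k' where k': "k' \<in> I" "leq j k'" "leq l k'" "f j k' y = f l k' z"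
      using b by (auto simp: rel_iff)
    obtain m where m: "m \<in> I" "leq k m" "leq k' m" using upper_bound k k' by blast
    have mem: "i \<in> I" "x \<in> carrier (G i)" "j \<in> I" "y \<in> carrier (G j)"
      "l \<in> I" "z \<in> carrier (G l)" using a b by (auto simp: rel_iff)
    have "f i m x = f k m (f i k x)"
      by (rule trans_comp[symmetric]) (use k m mem in simp_all)
    also have "\<dots> = f k m (f j k y)" using k(4) by (rule arg_cong)
    also have "\<dots> = f j m y" by (rule trans_comp) (use k m mem in simp_all)
    also have "\<dots> = f k' m (f j k' y)"
      by (rule trans_comp[symmetric]) (use k' m mem in simp_all)
    also have "\<dots> = f k' m (f l k' z)" using k'(4) by (rule arg_cong)
    also have "\<dots> = f l m z" by (rule trans_comp) (use k' m mem in simp_all)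
    finally have "f i m x = f l m z" .
    moreover have "leq i m" by (rule leI_trans[of i k m]) (use mem m k in simp_all)
    moreover have "leq l m" by (rule leI_trans[of l k' m]) (use mem m k' in simp_all)
    ultimately show "((i, x), (l, z)) \<in> R"
      unfolding rel_iff using mem m(1) by blast
  qed
qed

lemma dirlim_in_eq_iff:
  assumes "i \<in> I" "x \<in> carrier (G i)" "j \<in> I" "y \<in> carrier (G j)"
  shows "\<iota> i x = \<iota> j y \<longleftrightarrow> (\<exists>k\<in>I. leq i k \<and> leq j k \<and> f i k x = f j k y)"
  using eq_equiv_class_iff[OF equiv_rel, of "(i, x)" "(j, y)"] assms
  by (auto simp: dirlim_in_def rel_iff)

lemma dirlim_in_trans:
  assumes "i \<in> I" "j \<in> I" "leq i j" "x \<in> carrier (G i)"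
  shows "\<iota> j (f i j x) = \<iota> i x"
proof -
  have "f j j (f i j x) = f i j x" using assms trans_closed trans_id by simp
  then show ?thesis
    using assms trans_closed leI_refl[of j] by (subst dirlim_in_eq_iff) (auto intro!: bexI[of _ j])
qed

lemma dirlim_in_closed: "i \<in> I \<Longrightarrow> x \<in> carrier (G i) \<Longrightarrow> \<iota> i x \<in> carrier L"
  by (auto simp: direct_limit_def dirlim_in_def quotient_def)

lemma dirlim_cases:
  assumes "a \<in> carrier L"
  obtains i x where "i \<in> I" "x \<in> carrier (G i)" "a = \<iota> i x"
  using assms by (auto simp: direct_limit_def dirlim_in_def quotient_def)

lemma mem_dirlim_in:
  assumes "i \<in> I" "x \<in> carrier (G i)"
  shows "(j, y) \<in> \<iota> i x \<longleftrightarrow> j \<in> I \<and> y \<in> carrier (G j) \<and> \<iota> j y = \<iota> i x"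
  using assms equiv_class_eq_iff[OF equiv_rel, of "(i, x)" "(j, y)"]
  by (auto simp: dirlim_in_def)

lemma mult_indep:
  assumes "i \<in> I" "x \<in> carrier (G i)" "j \<in> I" "y \<in> carrier (G j)" "k \<in> I" "leq i k" "leq j k"
    and "i' \<in> I" "x' \<in> carrier (G i')" "j' \<in> I" "y' \<in> carrier (G j')" "k' \<in> I" "leq i' k'" "leq j' k'"
    and "\<iota> i x = \<iota> i' x'" "\<iota> j y = \<iota> j' y'"
  shows "\<iota> k (f i k x \<otimes>\<^bsub>G k\<^esub> f j k y) = \<iota> k' (f i' k' x' \<otimes>\<^bsub>G k'\<^esub> f j' k' y')"
proof -
  have "\<iota> k (f i k x) = \<iota> k' (f i' k' x')" using assms by (simp add: dirlim_in_trans)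
  then obtain m where m: "m \<in> I" "leq k m" "leq k' m" "f k m (f i k x) = f k' m (f i' k' x')"
    using dirlim_in_eq_iff trans_closed assms by auto
  have "\<iota> k (f j k y) = \<iota> k' (f j' k' y')" using assms by (simp add: dirlim_in_trans)
  then obtain n where n: "n \<in> I" "leq k n" "leq k' n" "f k n (f j k y) = f k' n (f j' k' y')"
    using dirlim_in_eq_iff trans_closed assms by auto
  obtain p where p: "p \<in> I" "leq m p" "leq n p" using upper_bound m n by blast
  have kp: "leq k p" "leq k' p" using leI_trans[of k m p] leI_trans[of k' m p] m p assms by auto
  note c = trans_closed[of i k x] trans_closed[of j k y] trans_closed[of i' k' x']
    trans_closed[of j' k' y']
  have "f k p (f i k x) = f m p (f k m (f i k x))"
    by (rule trans_comp[symmetric]) (use c assms m p in simp_all)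
  also have "\<dots> = f m p (f k' m (f i' k' x'))" using m(4) by (rule arg_cong)
  also have "\<dots> = f k' p (f i' k' x')"
    by (rule trans_comp) (use c assms m p in simp_all)
  finally have 1: "f k p (f i k x) = f k' p (f i' k' x')" .
  have "f k p (f j k y) = f n p (f k n (f j k y))"
    by (rule trans_comp[symmetric]) (use c assms n p in simp_all)
  also have "\<dots> = f n p (f k' n (f j' k' y'))" using n(4) by (rule arg_cong)
  also have "\<dots> = f k' p (f j' k' y')"
    by (rule trans_comp) (use c assms n p in simp_all)
  finally have 2: "f k p (f j k y) = f k' p (f j' k' y')" .
  have "f k p (f i k x \<otimes>\<^bsub>G k\<^esub> f j k y) = f k' p (f i' k' x' \<otimes>\<^bsub>G k'\<^esub> f j' k' y')"
    using 1 2 c assms p kp by (simp add: trans_mult)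
  moreover have "f i k x \<otimes>\<^bsub>G k\<^esub> f j k y \<in> carrier (G k)"
    "f i' k' x' \<otimes>\<^bsub>G k'\<^esub> f j' k' y' \<in> carrier (G k')"
    using c assms groups by (simp_all add: group.is_monoid monoid.m_closed)
  ultimately show ?thesis using assms p kp by (subst dirlim_in_eq_iff) auto
qed

lemma mult_dirlim_in:
  assumes "i \<in> I" "x \<in> carrier (G i)" "j \<in> I" "y \<in> carrier (G j)" "k \<in> I" "leq i k" "leq j k"
  shows "\<iota> i x \<otimes>\<^bsub>L\<^esub> \<iota> j y = \<iota> k (f i k x \<otimes>\<^bsub>G k\<^esub> f j k y)"
proof -
  have "\<iota> i x \<otimes>\<^bsub>L\<^esub> \<iota> j y = \<Union>{\<iota> k' (f i' k' x' \<otimes>\<^bsub>G k'\<^esub> f j' k' y') | i' x' j' y' k'.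
                 (i', x') \<in> \<iota> i x \<and> (j', y') \<in> \<iota> j y \<and> k' \<in> I \<and> leq i' k' \<and> leq j' k'}"
    by (simp add: direct_limit_def dirlim_in_def)
  also have "{\<iota> k' (f i' k' x' \<otimes>\<^bsub>G k'\<^esub> f j' k' y') | i' x' j' y' k'.
                 (i', x') \<in> \<iota> i x \<and> (j', y') \<in> \<iota> j y \<and> k' \<in> I \<and> leq i' k' \<and> leq j' k'}
      = {\<iota> k (f i k x \<otimes>\<^bsub>G k\<^esub> f j k y)}" (is "?S = {?c}")
  proof
    show "?S \<subseteq> {?c}"
    proof
      fix s assume "s \<in> ?S"
      then obtain i' x' j' y' k' where s: "s = \<iota> k' (f i' k' x' \<otimes>\<^bsub>G k'\<^esub> f j' k' y')"
        and *: "(i', x') \<in> \<iota> i x" "(j', y') \<in> \<iota> j y" "k' \<in> I" "leq i' k'" "leq j' k'" by blast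
      have "s = ?c" unfolding s
        by (rule mult_indep) (use * assms in \<open>simp_all add: mem_dirlim_in\<close>)
      then show "s \<in> {?c}" by simp
    qed
    have "(i, x) \<in> \<iota> i x" "(j, y) \<in> \<iota> j y" using assms by (simp_all add: mem_dirlim_in)
    then show "{?c} \<subseteq> ?S" using assms by blast
  qed
  finally show ?thesis by simp
qed

lemma mult_dirlim_in_same:
  assumes "i \<in> I" "x \<in> carrier (G i)" "y \<in> carrier (G i)"
  shows "\<iota> i x \<otimes>\<^bsub>L\<^esub> \<iota> i y = \<iota> i (x \<otimes>\<^bsub>G i\<^esub> y)"
  using mult_dirlim_in[of i x i y i] assms leI_refl trans_id by simp

lemma one_dirlim:
  assumes "i \<in> I"
  shows "\<one>\<^bsub>L\<^esub> = \<iota> i \<one>\<^bsub>G i\<^esub>"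
proof -
  have *: "\<iota> j \<one>\<^bsub>G j\<^esub> = \<iota> i \<one>\<^bsub>G i\<^esub>" if j: "j \<in> I" for j
  proof -
    obtain k where k: "k \<in> I" "leq i k" "leq j k" using upper_bound assms j by blast
    then show ?thesis
      using assms j groups by (subst dirlim_in_eq_iff)
        (auto simp: trans_one group.is_monoid monoid.one_closed intro!: bexI[of _ k])
  qed
  have "\<one>\<^bsub>L\<^esub> = (\<Union>j\<in>I. \<iota> j \<one>\<^bsub>G j\<^esub>)"
    by (simp add: direct_limit_def dirlim_in_def)
  also have "\<dots> = (\<Union>j\<in>I. \<iota> i \<one>\<^bsub>G i\<^esub>)" by (rule SUP_cong[OF refl *])
  also have "\<dots> = \<iota> i \<one>\<^bsub>G i\<^esub>" using assms by auto
  finally show ?thesis .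
qed

lemma common_rep:
  assumes "a \<in> carrier L" "j \<in> I"
  obtains k x where "k \<in> I" "leq j k" "x \<in> carrier (G k)" "a = \<iota> k x"
proof -
  obtain i x where i: "i \<in> I" "x \<in> carrier (G i)" "a = \<iota> i x" by (rule dirlim_cases[OF assms(1)])
  obtain k where k: "k \<in> I" "leq i k" "leq j k" using upper_bound assms i by blast
  show ?thesis
    by (rule that[of k "f i k x"]) (use i k assms in \<open>auto simp: trans_closed dirlim_in_trans\<close>)
qed

lemma common_rep2:
  assumes "a \<in> carrier L" "b \<in> carrier L"
  obtains k x y where "k \<in> I" "x \<in> carrier (G k)" "y \<in> carrier (G k)" "a = \<iota> k x" "b = \<iota> k y"
proof -
  obtain i x where i: "i \<in> I" "x \<in> carrier (G i)" "a = \<iota> i x" by (rule dirlim_cases[OF assms(1)])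
  obtain k y where k: "k \<in> I" "leq i k" "y \<in> carrier (G k)" "b = \<iota> k y"
    by (rule common_rep[OF assms(2) i(1)])
  show ?thesis
    by (rule that[of k "f i k x" y]) (use i k in \<open>auto simp: trans_closed dirlim_in_trans\<close>)
qed

lemma common_rep3:
  assumes "a \<in> carrier L" "b \<in> carrier L" "c \<in> carrier L"
  obtains k x y z where "k \<in> I" "x \<in> carrier (G k)" "y \<in> carrier (G k)" "z \<in> carrier (G k)"
    "a = \<iota> k x" "b = \<iota> k y" "c = \<iota> k z"
proof -
  obtain i x y where i: "i \<in> I" "x \<in> carrier (G i)" "y \<in> carrier (G i)" "a = \<iota> i x" "b = \<iota> i y"
    by (rule common_rep2[OF assms(1,2)])
  obtain k z where k: "k \<in> I" "leq i k" "z \<in> carrier (G k)" "c = \<iota> k z"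
    by (rule common_rep[OF assms(3) i(1)])
  show ?thesis
    by (rule that[of k "f i k x" "f i k y" z])
      (use i k in \<open>auto simp: trans_closed dirlim_in_trans\<close>)
qed

theorem group_direct_limit: "group L"
proof (rule groupI)
  fix a b assume "a \<in> carrier L" "b \<in> carrier L"
  then obtain k x y where "k \<in> I" "x \<in> carrier (G k)" "y \<in> carrier (G k)" "a = \<iota> k x" "b = \<iota> k y"
    by (rule common_rep2)
  then show "a \<otimes>\<^bsub>L\<^esub> b \<in> carrier L"
    using groups by (simp add: mult_dirlim_in_same dirlim_in_closed group.is_monoid monoid.m_closed)
next
  obtain i where "i \<in> I" using nonempty by blast
  then show "\<one>\<^bsub>L\<^esub> \<in> carrier L"
    using groups by (simp add: one_dirlim dirlim_in_closed group.is_monoid monoid.one_closed)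
next
  fix a b c assume "a \<in> carrier L" "b \<in> carrier L" "c \<in> carrier L"
  then obtain k x y z where "k \<in> I" "x \<in> carrier (G k)" "y \<in> carrier (G k)" "z \<in> carrier (G k)"
    "a = \<iota> k x" "b = \<iota> k y" "c = \<iota> k z" by (rule common_rep3)
  then show "a \<otimes>\<^bsub>L\<^esub> b \<otimes>\<^bsub>L\<^esub> c = a \<otimes>\<^bsub>L\<^esub> (b \<otimes>\<^bsub>L\<^esub> c)"
    using groups
    by (simp add: mult_dirlim_in_same group.is_monoid monoid.m_closed monoid.m_assoc)
next
  fix a assume a: "a \<in> carrier L"
  obtain i x where i: "i \<in> I" "x \<in> carrier (G i)" "a = \<iota> i x" by (rule dirlim_cases[OF a])
  interpret Gi: group "G i" using groups i by simp
  show "\<one>\<^bsub>L\<^esub> \<otimes>\<^bsub>L\<^esub> a = a" using i by (simp add: one_dirlim[OF i(1)] mult_dirlim_in_same)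
  show "\<exists>b\<in>carrier L. b \<otimes>\<^bsub>L\<^esub> a = \<one>\<^bsub>L\<^esub>"
    using i by (intro bexI[of _ "\<iota> i (inv\<^bsub>G i\<^esub> x)"])
      (simp_all add: one_dirlim[OF i(1)] mult_dirlim_in_same dirlim_in_closed)
qed

theorem dirlim_in_hom: "i \<in> I \<Longrightarrow> \<iota> i \<in> hom (G i) L"
  by (auto simp: hom_def dirlim_in_closed mult_dirlim_in_same)

theorem direct_limit_universal:
  fixes K :: "('b, 'n) monoid_scheme"
  assumes "group K"
    and g_hom: "\<And>i. i \<in> I \<Longrightarrow> g i \<in> hom (G i) K"
    and g_compat: "\<And>i j x. i \<in> I \<Longrightarrow> j \<in> I \<Longrightarrow> leq i j \<Longrightarrow> x \<in> carrier (G i) \<Longrightarrow> g j (f i j x) = g i x"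
  shows "\<exists>h \<in> hom L K. (\<forall>i\<in>I. \<forall>x\<in>carrier (G i). h (\<iota> i x) = g i x) \<and>
    (\<forall>h' \<in> hom L K. (\<forall>i\<in>I. \<forall>x\<in>carrier (G i). h' (\<iota> i x) = g i x)
       \<longrightarrow> (\<forall>a\<in>carrier L. h' a = h a))"
proof -
  define h where "h a = (SOME z. \<exists>i\<in>I. \<exists>x\<in>carrier (G i). a = \<iota> i x \<and> z = g i x)" for a
  have h: "h (\<iota> i x) = g i x" if ix: "i \<in> I" "x \<in> carrier (G i)" for i x
    unfolding h_def
  proof (rule some_equality)
    show "\<exists>j\<in>I. \<exists>y\<in>carrier (G j). \<iota> i x = \<iota> j y \<and> g i x = g j y" using ix by blast
    fix z assume "\<exists>j\<in>I. \<exists>y\<in>carrier (G j). \<iota> i x = \<iota> j y \<and> z = g j y"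
    then obtain j y where jy: "j \<in> I" "y \<in> carrier (G j)" "\<iota> i x = \<iota> j y" "z = g j y" by blast
    then obtain k where "k \<in> I" "leq i k" "leq j k" "f i k x = f j k y"
      using ix dirlim_in_eq_iff by blast
    then show "z = g i x" using g_compat[of i k x] g_compat[of j k y] ix jy by simp
  qed
  have "h \<in> hom L K"
  proof (rule homI)
    fix a assume a: "a \<in> carrier L"
    then show "h a \<in> carrier K"
      by (elim dirlim_cases) (use h hom_in_carrier[OF g_hom] in auto)
  next
    fix a b assume "a \<in> carrier L" "b \<in> carrier L"
    then obtain k x y where k: "k \<in> I" "x \<in> carrier (G k)" "y \<in> carrier (G k)"
      "a = \<iota> k x" "b = \<iota> k y" by (rule common_rep2)
    then show "h (a \<otimes>\<^bsub>L\<^esub> b) = h a \<otimes>\<^bsub>K\<^esub> h b"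
      using groups g_hom[OF k(1)]
      by (simp add: mult_dirlim_in_same h hom_mult group.is_monoid monoid.m_closed)
  qed
  then show ?thesis using h by (intro bexI[of _ h]) (auto elim!: dirlim_cases)
qed

end

end

(* A group is CSA iff any two elements commuting with a common y \<noteq> 1 commute with each other, and
   any x \<noteq> 1 commuting with its conjugate by y commutes with y.  Both conditions say that finitely
   many equations and one inequation imply an equation.  In a direct limit, equations already hold
   at some index, inequations hold at every index, and the equation obtained there is mapped to
   the limit. *)

theory Submission
  imports Defs
begin

lemma (in group) abelian_subgroup_iff:
  "abelian_subgroup H G \<longleftrightarrow> subgroup H G \<and> (\<forall>a\<in>H. \<forall>b\<in>H. a \<otimes> b = b \<otimes> a)"
proof -
  have "comm_group (G\<lparr>carrier := H\<rparr>) \<longleftrightarrow> (\<forall>a\<in>H. \<forall>b\<in>H. a \<otimes> b = b \<otimes> a)" if H: "subgroup H G"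
  proof
    assume "comm_group (G\<lparr>carrier := H\<rparr>)"
    then interpret K: comm_group "G\<lparr>carrier := H\<rparr>" .
    show "\<forall>a\<in>H. \<forall>b\<in>H. a \<otimes> b = b \<otimes> a" using K.m_comm by simp
  next
    assume "\<forall>a\<in>H. \<forall>b\<in>H. a \<otimes> b = b \<otimes> a"
    then show "comm_group (G\<lparr>carrier := H\<rparr>)"
      by (intro group.group_comm_groupI subgroup_imp_group H) simp
  qed
  then show ?thesis by (auto simp: abelian_subgroup_def)
qed

lemma (in group) commute_mult:
  assumes "a \<in> carrier G" "b \<in> carrier G" "c \<in> carrier G" "a \<otimes> c = c \<otimes> a" "b \<otimes> c = c \<otimes> b"
  shows "(a \<otimes> b) \<otimes> c = c \<otimes> (a \<otimes> b)"
  using assms m_assoc[of a b c] m_assoc[of a c b] m_assoc[of c a b] by simp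

lemma (in group) commute_inv:
  assumes "a \<in> carrier G" "c \<in> carrier G" "a \<otimes> c = c \<otimes> a"
  shows "inv a \<otimes> c = c \<otimes> inv a"
proof -
  have "c = inv a \<otimes> (a \<otimes> c)" using assms(1,2) by (simp add: m_assoc[symmetric])
  also have "\<dots> = (inv a \<otimes> c) \<otimes> a" unfolding assms(3) using assms(1,2) by (simp add: m_assoc)
  finally have "c \<otimes> inv a = ((inv a \<otimes> c) \<otimes> a) \<otimes> inv a" by (rule arg_cong)
  then show ?thesis using assms(1,2) by (simp add: m_assoc)
qed

text \<open>Serves for two choices of \<open>S\<close>: a maximal commuting set, which coincides
  with its centralizer and is thereby a subgroup, and a single element, whose centralizer is
  compared with a maximal abelian subgroup.\<close>

lemma (in group) subgroup_centralizer:
  assumes "S \<subseteq> carrier G"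
  shows "subgroup {a \<in> carrier G. \<forall>s\<in>S. a \<otimes> s = s \<otimes> a} G"
proof (rule subgroupI)
  have "\<one> \<in> {a \<in> carrier G. \<forall>s\<in>S. a \<otimes> s = s \<otimes> a}" using assms by (auto simp: subset_iff)
  then show "{a \<in> carrier G. \<forall>s\<in>S. a \<otimes> s = s \<otimes> a} \<noteq> {}" by blast
next
  fix a assume "a \<in> {a \<in> carrier G. \<forall>s\<in>S. a \<otimes> s = s \<otimes> a}"
  then show "inv a \<in> {a \<in> carrier G. \<forall>s\<in>S. a \<otimes> s = s \<otimes> a}"
    using assms commute_inv by blast
next
  fix a b
  assume "a \<in> {a \<in> carrier G. \<forall>s\<in>S. a \<otimes> s = s \<otimes> a}"
    "b \<in> {a \<in> carrier G. \<forall>s\<in>S. a \<otimes> s = s \<otimes> a}"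
  then show "a \<otimes> b \<in> {a \<in> carrier G. \<forall>s\<in>S. a \<otimes> s = s \<otimes> a}"
    using assms commute_mult by blast
next
  show "{a \<in> carrier G. \<forall>s\<in>S. a \<otimes> s = s \<otimes> a} \<subseteq> carrier G" by (rule Collect_restrict)
qed

text \<open>Zorn's lemma is applied to commuting subsets containing \<open>S\<close> instead of
  abelian subgroups, so \<open>S\<close> itself shows that the family is nonempty. A maximal
  commuting set equals its own centralizer, hence is a subgroup.\<close>

lemma (in group) maximal_abelian_subgroup_exists:
  assumes "S \<subseteq> carrier G" "\<And>a b. a \<in> S \<Longrightarrow> b \<in> S \<Longrightarrow> a \<otimes> b = b \<otimes> a"
  obtains M where "maximal_abelian_subgroup M G" "S \<subseteq> M"
proof -
  define A where "A = {T. S \<subseteq> T \<and> T \<subseteq> carrier G \<and> (\<forall>a\<in>T. \<forall>b\<in>T. a \<otimes> b = b \<otimes> a)}"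
  have "\<exists>M\<in>A. \<forall>X\<in>A. M \<subseteq> X \<longrightarrow> X = M"
  proof (rule subset_Zorn_nonempty)
    show "A \<noteq> {}" using assms by (auto simp: A_def)
    fix C assume C: "C \<noteq> {}" "subset.chain A C"
    have sub: "T \<in> A" if "T \<in> C" for T using C that by (auto simp: subset_chain_def)
    have "a \<otimes> b = b \<otimes> a" if ab: "a \<in> \<Union>C" "b \<in> \<Union>C" for a b
    proof -
      obtain T U where TU: "T \<in> C" "U \<in> C" "a \<in> T" "b \<in> U" using ab by blast
      then have "T \<subseteq> U \<or> U \<subseteq> T" using C(2) by (auto simp: subset_chain_def)
      then show ?thesis using TU sub[of T] sub[of U] by (auto simp: A_def)
    qed
    moreover have "S \<subseteq> \<Union>C" using C(1) sub by (fastforce simp: A_def)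
    moreover have "\<Union>C \<subseteq> carrier G" using sub by (auto simp: A_def)
    ultimately show "\<Union>C \<in> A" by (simp add: A_def)
  qed
  then obtain M where M: "M \<in> A" and max: "\<And>X. X \<in> A \<Longrightarrow> M \<subseteq> X \<Longrightarrow> X = M" by blast
  have self_centralizing: "M = {a \<in> carrier G. \<forall>s\<in>M. a \<otimes> s = s \<otimes> a}"
  proof
    show "M \<subseteq> {a \<in> carrier G. \<forall>s\<in>M. a \<otimes> s = s \<otimes> a}" using M by (auto simp: A_def)
    show "{a \<in> carrier G. \<forall>s\<in>M. a \<otimes> s = s \<otimes> a} \<subseteq> M"
    proof
      fix a assume a: "a \<in> {a \<in> carrier G. \<forall>s\<in>M. a \<otimes> s = s \<otimes> a}"
      \<comment> \<open>Adding an element of the centralizer leaves a commuting set, so maximality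
        forces it to be in \<open>M\<close> already.\<close>
      have "insert a M \<in> A" using a M unfolding A_def by auto
      then show "a \<in> M" using max[of "insert a M"] by blast
    qed
  qed
  have "subgroup M G"
    using subgroup_centralizer[of M] M self_centralizing by (simp add: A_def)
  then have "abelian_subgroup M G" using M by (simp add: abelian_subgroup_iff A_def)
  \<comment> \<open>An abelian subgroup above \<open>M\<close> is a member of \<open>A\<close>, so
    maximality among commuting sets gives maximality among abelian subgroups.\<close>
  moreover have "K = M" if K: "abelian_subgroup K G" "M \<subseteq> K" for K
  proof (rule max)
    show "K \<in> A" using K M subgroup.subset by (auto simp: A_def abelian_subgroup_iff)
  qed (rule K)
  ultimately show ?thesis using M that[of M] by (auto simp: maximal_abelian_subgroup_def A_def)
qed

text \<open>Multiplying \<open>h = inv x \<otimes> k \<otimes> x\<close> by \<open>x\<close> on the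
  left removes the inverse, and equations without inverses are what the characterization of
  CSA-groups uses.\<close>

lemma (in group) mem_conjugate_iff:
  assumes "H \<subseteq> carrier G" "x \<in> carrier G"
  shows "h \<in> (inv x <# H) #> x \<longleftrightarrow> h \<in> carrier G \<and> (\<exists>k\<in>H. k \<otimes> x = x \<otimes> h)"
proof -
  have "h = inv x \<otimes> k \<otimes> x \<longleftrightarrow> h \<in> carrier G \<and> k \<otimes> x = x \<otimes> h" if "k \<in> H" for k
    using that assms inv_solve_left[of h x "k \<otimes> x"] by (auto simp: m_assoc subset_iff)
  then show ?thesis by (auto simp: l_coset_def r_coset_def)
qed

text \<open>In the last conjunct \<open>z\<close> is the conjugate of \<open>x\<close> by \<open>y\<close>; the equation
  \<open>x \<otimes> y = y \<otimes> z\<close> keeps the condition free of inverses.\<close>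

lemma CSA_group_iff:
  fixes G (structure)
  shows "CSA_group G \<longleftrightarrow> group G \<and>
    (\<forall>x\<in>carrier G. \<forall>y\<in>carrier G. \<forall>z\<in>carrier G. y \<noteq> \<one> \<longrightarrow>
       x \<otimes> y = y \<otimes> x \<longrightarrow> y \<otimes> z = z \<otimes> y \<longrightarrow> x \<otimes> z = z \<otimes> x) \<and>
    (\<forall>x\<in>carrier G. \<forall>y\<in>carrier G. \<forall>z\<in>carrier G. x \<noteq> \<one> \<longrightarrow>
       x \<otimes> y = y \<otimes> z \<longrightarrow> x \<otimes> z = z \<otimes> x \<longrightarrow> x \<otimes> y = y \<otimes> x)"
  (is "_ \<longleftrightarrow> _ \<and> ?transitive \<and> ?conjugate")
proof (intro iffI conjI)
  assume csa: "CSA_group G"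
  then interpret group G by (simp add: CSA_group_def)
  show "group G" ..
  \<comment> \<open>Here \<open>z\<close> is the conjugate of \<open>x\<close> by \<open>y\<close>,
    so it is a nontrivial element of both \<open>M\<close> and its conjugate by \<open>y\<close>.
    Both conditions are instances of this.\<close>
  have separated: "y \<in> M"
    if M: "maximal_abelian_subgroup M G" and "x \<in> M" "z \<in> M" "z \<noteq> \<one>" "y \<in> carrier G" "x \<otimes> y = y \<otimes> z"
    for M x y z
  proof (rule ccontr)
    assume "y \<notin> M"
    then have "M \<inter> ((inv y <# M) #> y) = {\<one>}"
      using csa that by (auto simp: CSA_group_def conjugately_separated_def)
    moreover have "M \<subseteq> carrier G"
      using M subgroup.subset by (auto simp: maximal_abelian_subgroup_def abelian_subgroup_iff)
    then have "z \<in> (inv y <# M) #> y" using that by (auto simp: mem_conjugate_iff)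
    ultimately show False using that by blast
  qed
  have commute: "x \<otimes> y = y \<otimes> x" if "maximal_abelian_subgroup M G" "x \<in> M" "y \<in> M" for M x y
    using that by (simp add: maximal_abelian_subgroup_def abelian_subgroup_iff)
  show ?transitive
  proof (intro ballI impI)
    fix x y z
    assume *: "x \<in> carrier G" "y \<in> carrier G" "z \<in> carrier G" "y \<noteq> \<one>"
      "x \<otimes> y = y \<otimes> x" "y \<otimes> z = z \<otimes> y"
    obtain M where M: "maximal_abelian_subgroup M G" "{x, y} \<subseteq> M"
      by (rule maximal_abelian_subgroup_exists[of "{x, y}"]) (use * in auto)
    \<comment> \<open>Since \<open>z\<close> commutes with \<open>y\<close>, conjugation by
      \<open>z\<close> fixes the nontrivial element \<open>y\<close> of \<open>M\<close>.\<close>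
    have "z \<in> M" by (rule separated[of M y y z]) (use * M in auto)
    then show "x \<otimes> z = z \<otimes> x" using commute M by simp
  qed
  show ?conjugate
  proof (intro ballI impI)
    fix x y z
    assume *: "x \<in> carrier G" "y \<in> carrier G" "z \<in> carrier G" "x \<noteq> \<one>"
      "x \<otimes> y = y \<otimes> z" "x \<otimes> z = z \<otimes> x"
    obtain M where M: "maximal_abelian_subgroup M G" "{x, z} \<subseteq> M"
      by (rule maximal_abelian_subgroup_exists[of "{x, z}"]) (use * in auto)
    \<comment> \<open>If \<open>z\<close> were trivial, \<open>x \<otimes> y = y\<close> would make
      \<open>x\<close> trivial.\<close>
    have "z \<noteq> \<one>" using * r_cancel_one' by auto
    then have "y \<in> M" using separated[of M x z y] * M by auto
    then show "x \<otimes> y = y \<otimes> x" using commute M by simp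
  qed
next
  assume *: "group G \<and> ?transitive \<and> ?conjugate"
  then interpret group G by simp
  have transitive: "a \<otimes> b = b \<otimes> a"
    if "a \<in> carrier G" "b \<in> carrier G" "k \<in> carrier G" "k \<noteq> \<one>" "a \<otimes> k = k \<otimes> a" "k \<otimes> b = b \<otimes> k"
    for a b k using * that by blast
  have conjugate: "k \<otimes> x = x \<otimes> k"
    if "k \<in> carrier G" "x \<in> carrier G" "h \<in> carrier G" "k \<noteq> \<one>" "k \<otimes> x = x \<otimes> h" "k \<otimes> h = h \<otimes> k"
    for h k x using * that by blast
  have "conjugately_separated H G" if H: "maximal_abelian_subgroup H G" for H
  proof -
    have sub: "subgroup H G" and comm: "\<And>a b. a \<in> H \<Longrightarrow> b \<in> H \<Longrightarrow> a \<otimes> b = b \<otimes> a"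
      and max: "\<And>K. abelian_subgroup K G \<Longrightarrow> H \<subseteq> K \<Longrightarrow> K = H"
      using H by (auto simp: maximal_abelian_subgroup_def abelian_subgroup_iff)
    note Hc = subgroup.subset[OF sub]
    have "x \<in> H"
      \<comment> \<open>A nontrivial \<open>h\<close> in the intersection is the conjugate by
        \<open>x\<close> of some \<open>k\<close> in \<open>H\<close>. These commute because
        \<open>H\<close> is abelian, so the conjugate condition makes \<open>x\<close> commute with
        \<open>k\<close>. It remains to see that the centralizer of \<open>k\<close> is
        \<open>H\<close>.\<close>
      if x: "x \<in> carrier G" and h: "h \<in> H" "h \<in> (inv x <# H) #> x" "h \<noteq> \<one>" for x h
    proof -
      obtain k where k: "k \<in> H" "k \<otimes> x = x \<otimes> h"
        using h x Hc by (auto simp: mem_conjugate_iff)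
      have kc: "k \<in> carrier G" and hc: "h \<in> carrier G" using k h Hc by auto
      have "k \<noteq> \<one>" using k x h hc r_cancel_one[of x h] by auto
      then have kx: "k \<otimes> x = x \<otimes> k" using conjugate[of k x h] k x h hc kc comm by blast
      define C where "C = {a \<in> carrier G. \<forall>s\<in>{k}. a \<otimes> s = s \<otimes> a}"
      have C: "a \<in> C \<longleftrightarrow> a \<in> carrier G \<and> a \<otimes> k = k \<otimes> a" for a by (simp add: C_def)
      have "subgroup C G" unfolding C_def by (rule subgroup_centralizer) (simp add: kc)
      \<comment> \<open>Transitivity of commutation through the nontrivial \<open>k\<close> makes
        its centralizer abelian; as it contains \<open>H\<close>, maximality of \<open>H\<close>
        gives equality.\<close>
      moreover have "a \<otimes> b = b \<otimes> a" if "a \<in> C" "b \<in> C" for a b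
        by (rule transitive[of a b k]) (use \<open>k \<noteq> \<one>\<close> kc that in \<open>simp_all add: C\<close>)
      ultimately have "abelian_subgroup C G" by (simp only: abelian_subgroup_iff) blast
      then have "C = H" by (rule max) (use Hc comm k(1) C in blast)
      then show ?thesis using kx x C by auto
    qed
    moreover have "\<one> \<in> H \<inter> ((inv x <# H) #> x)" if "x \<in> carrier G" for x
      using that subgroup.one_closed[OF sub] Hc by (auto simp: mem_conjugate_iff intro!: bexI[of _ \<one>])
    ultimately have "H \<inter> ((inv x <# H) #> x) = {\<one>}" if "x \<in> carrier G - H" for x
      using that by blast
    then show ?thesis using sub by (simp add: conjugately_separated_def)
  qed
  then show "CSA_group G" by (simp add: CSA_group_def)
qed

text \<open>Each equation holds at some index above \<open>i\<close>, and transition maps preserve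
  it, so an upper bound of the two indices serves both. Two equations are treated because each CSA
  condition has two as hypotheses.\<close>

lemma (in direct_system) dirlim_in_eq_common2:
  assumes "i \<in> I" "{p, q, r, s} \<subseteq> carrier (G i)" "\<iota> i p = \<iota> i q" "\<iota> i r = \<iota> i s"
  obtains k where "k \<in> I" "leq i k" "f i k p = f i k q" "f i k r = f i k s"
proof -
  obtain m where m: "m \<in> I" "leq i m" "f i m p = f i m q"
    using assms dirlim_in_eq_iff[of i p i q] by auto
  obtain n where n: "n \<in> I" "leq i n" "f i n r = f i n s"
    using assms dirlim_in_eq_iff[of i r i s] by auto
  obtain k where k: "k \<in> I" "leq m k" "leq n k" using upper_bound m n by blast
  have "f i k p = f i k q" "f i k r = f i k s"
    using trans_comp[of i m k p] trans_comp[of i m k q] trans_comp[of i n k r] trans_comp[of i n k s]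
      assms m n k by auto
  then show ?thesis using that[of k] k leI_trans[of i m k] assms m by blast
qed

theorem theorem6:
  fixes I :: "'i set" and leq :: "'i \<Rightarrow> 'i \<Rightarrow> bool"
    and G :: "'i \<Rightarrow> ('a, 'm) monoid_scheme" and f :: "'i \<Rightarrow> 'i \<Rightarrow> 'a \<Rightarrow> 'a"
  assumes "direct_system I leq G f"
    and "\<And>i. i \<in> I \<Longrightarrow> CSA_group (G i)"
  shows "CSA_group (direct_limit I leq G f)"
proof -
  interpret direct_system I leq G f by fact
  have closed: "x \<otimes>\<^bsub>G i\<^esub> y \<in> carrier (G i)"
    if "i \<in> I" "x \<in> carrier (G i)" "y \<in> carrier (G i)" for i x y
    using that groups by (simp add: group.is_monoid monoid.m_closed)
  have commute_lim: "\<iota> i x \<otimes>\<^bsub>L\<^esub> \<iota> i y = \<iota> i y \<otimes>\<^bsub>L\<^esub> \<iota> i x"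
    if i: "i \<in> I" "x \<in> carrier (G i)" "y \<in> carrier (G i)" and k: "k \<in> I" "leq i k"
      and eq: "f i k x \<otimes>\<^bsub>G k\<^esub> f i k y = f i k y \<otimes>\<^bsub>G k\<^esub> f i k x" for i k x y
    using mult_dirlim_in[of i x i y k] mult_dirlim_in[of i y i x k] that by simp
  \<comment> \<open>The element \<open>f i k x\<close> has the same image in the limit as
    \<open>x\<close>, so it can be trivial only if that image is.\<close>
  have neq: "f i k x \<noteq> \<one>\<^bsub>G k\<^esub>"
    if "i \<in> I" "x \<in> carrier (G i)" "k \<in> I" "leq i k" "\<iota> i x \<noteq> \<one>\<^bsub>L\<^esub>" for i k x
    using that dirlim_in_trans[of i k x] one_dirlim[of k] by auto
  show ?thesis
    unfolding CSA_group_iff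
  proof (intro conjI ballI impI)
    show "group L" by (rule group_direct_limit)
  next
    fix a b c
    assume abc: "a \<in> carrier L" "b \<in> carrier L" "c \<in> carrier L" and ne: "b \<noteq> \<one>\<^bsub>L\<^esub>"
      and eqs: "a \<otimes>\<^bsub>L\<^esub> b = b \<otimes>\<^bsub>L\<^esub> a" "b \<otimes>\<^bsub>L\<^esub> c = c \<otimes>\<^bsub>L\<^esub> b"
    obtain i x y z where i: "i \<in> I" and xyz: "x \<in> carrier (G i)" "y \<in> carrier (G i)" "z \<in> carrier (G i)"
      and reps: "a = \<iota> i x" "b = \<iota> i y" "c = \<iota> i z" by (rule common_rep3[OF abc])
    \<comment> \<open>With all representatives at the single index \<open>i\<close>, the equations
      in the limit equate images of products formed in \<open>G i\<close>.\<close>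
    obtain k where k: "k \<in> I" "leq i k"
      and lifted: "f i k (x \<otimes>\<^bsub>G i\<^esub> y) = f i k (y \<otimes>\<^bsub>G i\<^esub> x)" "f i k (y \<otimes>\<^bsub>G i\<^esub> z) = f i k (z \<otimes>\<^bsub>G i\<^esub> y)"
      by (rule dirlim_in_eq_common2[OF i, of "x \<otimes>\<^bsub>G i\<^esub> y" "y \<otimes>\<^bsub>G i\<^esub> x" "y \<otimes>\<^bsub>G i\<^esub> z" "z \<otimes>\<^bsub>G i\<^esub> y"])
        (use i xyz eqs closed in \<open>auto simp: reps mult_dirlim_in_same\<close>)
    have "f i k y \<noteq> \<one>\<^bsub>G k\<^esub>" using neq i k xyz ne reps by simp
    moreover have "f i k x \<otimes>\<^bsub>G k\<^esub> f i k y = f i k y \<otimes>\<^bsub>G k\<^esub> f i k x"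
      "f i k y \<otimes>\<^bsub>G k\<^esub> f i k z = f i k z \<otimes>\<^bsub>G k\<^esub> f i k y"
      using lifted i k xyz by (simp_all add: trans_mult)
    \<comment> \<open>The transitivity condition in \<open>G k\<close> applies to the images of
      \<open>x\<close>, \<open>y\<close>, \<open>z\<close> at \<open>k\<close>.\<close>
    ultimately have "f i k x \<otimes>\<^bsub>G k\<^esub> f i k z = f i k z \<otimes>\<^bsub>G k\<^esub> f i k x"
      using assms(2)[OF k(1)] trans_closed[OF i k] xyz unfolding CSA_group_iff by blast
    then show "a \<otimes>\<^bsub>L\<^esub> c = c \<otimes>\<^bsub>L\<^esub> a" using commute_lim i k xyz reps by simp
  next
    fix a b c
    assume abc: "a \<in> carrier L" "b \<in> carrier L" "c \<in> carrier L" and ne: "a \<noteq> \<one>\<^bsub>L\<^esub>"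
      and eqs: "a \<otimes>\<^bsub>L\<^esub> b = b \<otimes>\<^bsub>L\<^esub> c" "a \<otimes>\<^bsub>L\<^esub> c = c \<otimes>\<^bsub>L\<^esub> a"
    obtain i x y z where i: "i \<in> I" and xyz: "x \<in> carrier (G i)" "y \<in> carrier (G i)" "z \<in> carrier (G i)"
      and reps: "a = \<iota> i x" "b = \<iota> i y" "c = \<iota> i z" by (rule common_rep3[OF abc])
    obtain k where k: "k \<in> I" "leq i k"
      and lifted: "f i k (x \<otimes>\<^bsub>G i\<^esub> y) = f i k (y \<otimes>\<^bsub>G i\<^esub> z)" "f i k (x \<otimes>\<^bsub>G i\<^esub> z) = f i k (z \<otimes>\<^bsub>G i\<^esub> x)"
      by (rule dirlim_in_eq_common2[OF i, of "x \<otimes>\<^bsub>G i\<^esub> y" "y \<otimes>\<^bsub>G i\<^esub> z" "x \<otimes>\<^bsub>G i\<^esub> z" "z \<otimes>\<^bsub>G i\<^esub> x"])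
        (use i xyz eqs closed in \<open>auto simp: reps mult_dirlim_in_same\<close>)
    have "f i k x \<noteq> \<one>\<^bsub>G k\<^esub>" using neq i k xyz ne reps by simp
    moreover have "f i k x \<otimes>\<^bsub>G k\<^esub> f i k y = f i k y \<otimes>\<^bsub>G k\<^esub> f i k z"
      "f i k x \<otimes>\<^bsub>G k\<^esub> f i k z = f i k z \<otimes>\<^bsub>G k\<^esub> f i k x"
      using lifted i k xyz by (simp_all add: trans_mult)
    \<comment> \<open>Now the conjugate condition in \<open>G k\<close> applies: at
      \<open>k\<close>, the image of \<open>z\<close> is the conjugate of the image of
      \<open>x\<close> by that of \<open>y\<close>.\<close>
    ultimately have "f i k x \<otimes>\<^bsub>G k\<^esub> f i k y = f i k y \<otimes>\<^bsub>G k\<^esub> f i k x"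
      using assms(2)[OF k(1)] trans_closed[OF i k] xyz unfolding CSA_group_iff by blast
    then show "a \<otimes>\<^bsub>L\<^esub> b = b \<otimes>\<^bsub>L\<^esub> a" using commute_lim i k xyz reps by simp
  qed
qed

end
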